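(* Let $P_{\mathrm{rook}}(t)=\sum_{n\ge 0}p_{\mathrm{rook},n}t^n$, where $p_{\mathrm{rook},n}$ is the number of Catalan rook paths from $(0,0)$ to $(n,n)$. Then, as formal power series, $$P_{\mathrm{rook}}(t)=\frac{1+3t-\sqrt{1-10t+9t^2}}{8t}=\frac{\beta}{2},\qquad\text{where } \beta=\frac{1+3t-\sqrt{1-10t+9t^2}}{4t}.$$
   Context: A lattice path with step set $S\subseteq\mathbb{N}\times\mathbb{N}$ from $(0,0)$ to $(n,m)$ is a finite (possibly empty) sequence of steps in $S$ summing to $(n,m)$; its nodes are $(0,0)$ and the points reached after each step. The path is Catalan if every node $(x,y)$ satisfies $x<y+1$, i.e. $x\le y$. A rook path is a path with step set $S=\{(a,0),(0,a):a>0\}$, $a$ an integer. The square root is the power series square root with constant term $1$. *)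

theory Defs
  imports
    Complex_Main
    "HOL-Library.Product_Plus"
    "HOL-Computational_Algebra.Formal_Power_Series"
begin

text \<open>
  A path is represented by its list of steps; the addition on pairs is componentwise,
  so \<^const>\<open>sum_list\<close> gives the end point.
\<close>

definition lattice_paths :: "(nat \<times> nat) set \<Rightarrow> nat \<times> nat \<Rightarrow> (nat \<times> nat) list set" where
  "lattice_paths S p = {ss. set ss \<subseteq> S \<and> sum_list ss = p}"

definition path_nodes :: "(nat \<times> nat) list \<Rightarrow> (nat \<times> nat) set" where
  "path_nodes ss = {sum_list (take k ss) |k. k \<le> length ss}"

definition catalan_path :: "(nat \<times> nat) list \<Rightarrow> bool" where
  "catalan_path ss \<longleftrightarrow> (\<forall>(x, y) \<in> path_nodes ss. x < y + 1)"

definition rook_steps :: "(nat \<times> nat) set" where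
  "rook_steps = {(a, 0) |a. a > 0} \<union> {(0, a) |a. a > 0}"

definition catalan_rook_paths :: "nat \<Rightarrow> (nat \<times> nat) list set" where
  "catalan_rook_paths n = {ss \<in> lattice_paths rook_steps (n, n). catalan_path ss}"

definition p_rook :: "nat \<Rightarrow> nat" where
  "p_rook n = card (catalan_rook_paths n)"

definition P_rook :: "real fps" where
  "P_rook = Abs_fps (\<lambda>n. of_nat (p_rook n))"

definition fps_sqrt :: "real fps \<Rightarrow> real fps" where
  "fps_sqrt f = fps_radical root 2 f"

text \<open>
  Division of formal power series truncates unless the divisor divides the dividend;
  \<open>rook_numerator_dvd\<close> below shows that it does for \<open>c = 4\<close> and \<open>c = 8\<close>.
\<close>

definition rook_beta :: "real fps" where
  "rook_beta = (1 + 3 * fps_X - fps_sqrt (1 - 10 * fps_X + 9 * fps_X ^ 2)) / (4 * fps_X)"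

lemma fps_sqrt_unique:
  assumes "fps_nth f 0 = 1"
  shows "s ^ 2 = f \<and> fps_nth s 0 = 1 \<longleftrightarrow> s = fps_sqrt f"
proof -
  have root: "root (Suc 1) (fps_nth f 0) = 1"
    using assms by simp
  have nth0: "fps_nth (fps_sqrt f) 0 = 1"
    using assms by (simp add: fps_sqrt_def)
  have "s ^ Suc 1 = f \<longleftrightarrow> s = fps_radical root (Suc 1) f" if "fps_nth s 0 = 1"
    by (rule radical_unique) (use assms root that in auto)
  then show ?thesis
    using nth0 by (auto simp: fps_sqrt_def numeral_2_eq_2)
qed

lemma rook_numerator_dvd:
  fixes c :: real
  assumes "c \<noteq> 0"
  shows "fps_const c * fps_X dvd 1 + 3 * fps_X - fps_sqrt (1 - 10 * fps_X + 9 * fps_X ^ 2)"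
proof -
  let ?N = "1 + 3 * fps_X - fps_sqrt (1 - 10 * fps_X + 9 * fps_X ^ 2)"
  have nth0: "fps_nth ?N 0 = 0"
    by (simp add: fps_sqrt_def)
  then have "?N = fps_X * fps_shift 1 ?N"
    by (intro fps_ext) (simp only: fps_X_mult_nth fps_shift_nth, auto)
  also have "\<dots> = fps_const c * fps_const (1 / c) * fps_X * fps_shift 1 ?N"
    using assms by (simp only: fps_const_mult) simp
  also have "\<dots> = (fps_const c * fps_X) * (fps_const (1 / c) * fps_shift 1 ?N)"
    by (simp only: ac_simps)
  finally show ?thesis
    by (metis dvd_triv_left)
qed

text \<open>\<^const>\<open>card\<close> is a genuine count in \<^const>\<open>p_rook\<close>:\<close>

lemma sum_list_length_le:
  "set ss \<subseteq> rook_steps \<Longrightarrow> length ss \<le> fst (sum_list ss) + snd (sum_list ss)"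
  by (induction ss) (auto simp: rook_steps_def)

lemma finite_catalan_rook_paths: "finite (catalan_rook_paths n)"
proof (rule finite_subset)
  show "catalan_rook_paths n \<subseteq>
      {ss. set ss \<subseteq> {..n} \<times> {..n} \<and> length ss \<le> 2 * n}"
  proof
    fix ss assume "ss \<in> catalan_rook_paths n"
    then have steps: "set ss \<subseteq> rook_steps" and total: "sum_list ss = (n, n)"
      by (auto simp: catalan_rook_paths_def lattice_paths_def)
    have bound: "fst s \<le> fst (sum_list ss) \<and> snd s \<le> snd (sum_list ss)" if "s \<in> set ss" for s
      using that by (induction ss) auto
    have "set ss \<subseteq> {..n} \<times> {..n}"
      using bound total by fastforce
    moreover have "length ss \<le> 2 * n"
      using sum_list_length_le[OF steps] total by simp
    ultimately show "ss \<in> {ss. set ss \<subseteq> {..n} \<times> {..n} \<and> length ss \<le> 2 * n}"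
      by blast
  qed
  show "finite {ss. set ss \<subseteq> {..n} \<times> {..n} \<and> length ss \<le> 2 * n}"
    by (rule finite_lists_length_le) simp
qed

end

theory Submission
  imports Defs
begin

text \<open>
  Count paths from any height \<open>h\<close> above the diagonal back to it, weighting up-steps by \<open>t\<close>, and
  let \<open>F h\<close> be the resulting power series and \<open>U h\<close> the part contributed by paths that start
  with an up-step. Splitting off the first step gives
  \<open>F h = [h = 0] + U h + (\<Sum>i<h. F i)\<close> and \<open>U h = t (F (h + 1) + U (h + 1))\<close>,
  which determines both families. If \<open>p\<close> is the power series root of \<open>4tp\<^sup>2 - (1 + 3t)p + 1 = 0\<close>,
  the system is solved by \<open>F 0 = p\<close>, \<open>F (k + 1) = (2p - 1) p (2p)^k\<close>, \<open>U h = (p - 1) (2p)^h\<close>,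
  so the series sought is \<open>F 0 = p\<close>. The closed forms come from a geometric ansatz of ratio \<open>\<beta> = 2p\<close>.
\<close>

text \<open>The starting point is translated to the origin, so the diagonal becomes
  \<open>x = h + y\<close> and removing a first step stays within the family.\<close>

definition rook_paths_from :: "nat \<Rightarrow> nat \<Rightarrow> (nat \<times> nat) list set" where
  "rook_paths_from h n = {ss \<in> lattice_paths rook_steps (h + n, n).
     \<forall>(x, y) \<in> path_nodes ss. x \<le> h + y}"

lemma rook_paths_from_0: "rook_paths_from 0 n = catalan_rook_paths n"
  by (auto simp: rook_paths_from_def catalan_rook_paths_def catalan_path_def less_Suc_eq_le)

lemma path_nodes_Nil: "path_nodes [] = {(0, 0)}"
  by (auto simp: path_nodes_def zero_prod_def)

lemma path_nodes_Cons: "path_nodes (s # ss) = insert (0, 0) ((+) s ` path_nodes ss)"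
proof -
  have "path_nodes (s # ss) = (\<lambda>k. sum_list (take k (s # ss))) ` {..Suc (length ss)}"
    by (auto simp: path_nodes_def)
  also have "{..Suc (length ss)} = insert 0 (Suc ` {..length ss})"
    by (auto simp: image_iff atMost_Suc_eq_insert_0)
  also have "(\<lambda>k. sum_list (take k (s # ss))) ` \<dots>
      = insert (0, 0) ((+) s ` (\<lambda>k. sum_list (take k ss)) ` {..length ss})"
    by (simp add: image_image zero_prod_def)
  also have "(\<lambda>k. sum_list (take k ss)) ` {..length ss} = path_nodes ss"
    by (auto simp: path_nodes_def)
  finally show ?thesis .
qed

lemma origin_in_path_nodes: "(0, 0) \<in> path_nodes ss"
  by (cases ss) (auto simp: path_nodes_Nil path_nodes_Cons)

lemma Nil_in_rook_paths_from: "[] \<in> rook_paths_from h n \<longleftrightarrow> h = 0 \<and> n = 0"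
  by (auto simp: rook_paths_from_def lattice_paths_def path_nodes_Nil zero_prod_def)

lemma up_Cons_in_rook_paths_from:
  assumes "a > 0"
  shows "(0, a) # ss \<in> rook_paths_from h n \<longleftrightarrow> a \<le> n \<and> ss \<in> rook_paths_from (h + a) (n - a)"
proof -
  have "(0, a) + sum_list ss = (h + n, n) \<longleftrightarrow>
      a \<le> n \<and> sum_list ss = (h + a + (n - a), n - a)"
    by (cases "sum_list ss") auto
  then show ?thesis
    using assms
    by (auto simp: rook_paths_from_def lattice_paths_def path_nodes_Cons rook_steps_def
        add.assoc split_beta)
qed

lemma right_Cons_in_rook_paths_from:
  assumes "a > 0"
  shows "(a, 0) # ss \<in> rook_paths_from h n \<longleftrightarrow> a \<le> h \<and> ss \<in> rook_paths_from (h - a) n"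
proof -
  \<comment> \<open>The bound \<open>a \<le> h\<close> comes from the node \<open>(a, 0)\<close>,
    the shifted origin of the tail; it keeps \<open>h - a\<close> from truncating.\<close>
  have nodes: "(\<forall>(x, y) \<in> path_nodes ((a, 0) # ss). x \<le> h + y) \<longleftrightarrow>
      a \<le> h \<and> (\<forall>(x, y) \<in> path_nodes ss. x \<le> h - a + y)"
    using origin_in_path_nodes[of ss] by (fastforce simp: path_nodes_Cons split_beta)
  have "(a, 0) + sum_list ss = (h + n, n) \<longleftrightarrow> sum_list ss = (h - a + n, n)" if "a \<le> h"
    using that by (cases "sum_list ss") auto
  then show ?thesis
    using assms nodes by (auto simp: rook_paths_from_def lattice_paths_def rook_steps_def)
qed

text \<open>Right-steps are indexed by the height \<open>i\<close> they lead to, so that their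
  contribution becomes a sum over \<open>i < h\<close>.\<close>

lemma rook_paths_from_unfold:
  "rook_paths_from h n = (if h = 0 \<and> n = 0 then {[]} else {})
     \<union> (\<Union>a\<in>{1..n}. Cons (0, a) ` rook_paths_from (h + a) (n - a))
     \<union> (\<Union>i<h. Cons (h - i, 0) ` rook_paths_from i n)" (is "?L = ?E \<union> ?V \<union> ?R")
proof (rule set_eqI)
  fix ss
  show "ss \<in> ?L \<longleftrightarrow> ss \<in> ?E \<union> ?V \<union> ?R"
  proof (cases ss)
    case Nil
    then show ?thesis by (auto simp: Nil_in_rook_paths_from)
  next
    case (Cons s ts)
    have right: "s # ts \<in> ?R \<longleftrightarrow>
        (\<exists>a>0. s = (a, 0) \<and> a \<le> h \<and> ts \<in> rook_paths_from (h - a) n)" (is "?A \<longleftrightarrow> ?B")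
    proof
      assume ?A
      then obtain i where "i < h" "s = (h - i, 0)" "ts \<in> rook_paths_from i n" by auto
      then show ?B by (intro exI[of _ "h - i"]) auto
    next
      assume ?B
      then obtain a where "a > 0" "s = (a, 0)" "a \<le> h" "ts \<in> rook_paths_from (h - a) n" by auto
      then show ?A by (intro UN_I[of "h - a"]) auto
    qed
    have up: "s # ts \<in> ?V \<longleftrightarrow>
        (\<exists>a>0. s = (0, a) \<and> a \<le> n \<and> ts \<in> rook_paths_from (h + a) (n - a))"
      by (auto simp: Suc_le_eq)
    have "s # ts \<in> ?L \<Longrightarrow> s \<in> rook_steps"
      by (auto simp: rook_paths_from_def lattice_paths_def)
    then have "s # ts \<in> ?L \<longleftrightarrow> s # ts \<in> ?V \<or> s # ts \<in> ?R"
      unfolding up right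
      using up_Cons_in_rook_paths_from right_Cons_in_rook_paths_from
      by (fastforce simp: rook_steps_def)
    then show ?thesis using Cons by auto
  qed
qed

lemma finite_rook_paths_from: "finite (rook_paths_from h n)"
proof (induction n arbitrary: h rule: less_induct)
  case (less n)
  note IHn = less.IH
  \<comment> \<open>An up-step raises \<open>h\<close> but lowers \<open>n\<close>, and a right-step
    lowers \<open>h\<close> at fixed \<open>n\<close>, so the recursion descends lexicographically
    in \<open>(n, h)\<close>.\<close>
  show ?case
  proof (induction h rule: less_induct)
    case (less h)
    show ?case
      by (subst rook_paths_from_unfold) (auto intro!: finite_imageI IHn less.IH)
  qed
qed

definition up_count :: "nat \<Rightarrow> nat \<Rightarrow> nat" where
  "up_count h n = (\<Sum>a=1..n. card (rook_paths_from (h + a) (n - a)))"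

lemma card_rook_paths_from:
  "card (rook_paths_from h n) = (if h = 0 \<and> n = 0 then 1 else 0)
     + up_count h n + (\<Sum>i<h. card (rook_paths_from i n))"
proof -
  let ?E = "if h = 0 \<and> n = 0 then {[]} else {} :: (nat \<times> nat) list set"
  let ?V = "\<Union>a\<in>{1..n}. Cons (0, a) ` rook_paths_from (h + a) (n - a)"
  let ?R = "\<Union>i<h. Cons (h - i, 0) ` rook_paths_from i n"
  have "card ?V = up_count h n"
    unfolding up_count_def
    by (subst card_UN_disjoint) (auto simp: finite_rook_paths_from card_image)
  moreover have "card ?R = (\<Sum>i<h. card (rook_paths_from i n))"
    by (subst card_UN_disjoint) (auto simp: finite_rook_paths_from card_image)
  moreover have "card (?E \<union> ?V \<union> ?R) = card ?E + card ?V + card ?R"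
    by (subst card_Un_disjoint; (subst card_Un_disjoint)?)
       (auto simp: finite_rook_paths_from split: if_splits)
  ultimately show ?thesis
    by (subst rook_paths_from_unfold) auto
qed

lemma up_count_0: "up_count h 0 = 0"
  by (simp add: up_count_def)

text \<open>A first up-step of length \<open>a + 1\<close> from height \<open>h\<close> acts like
  one of length \<open>a\<close> from height \<open>h + 1\<close>. This replaces the sum over step
  lengths by a two-term recurrence.\<close>

lemma up_count_Suc:
  "up_count h (Suc n) = card (rook_paths_from (Suc h) n) + up_count (Suc h) n"
proof -
  have "up_count h (Suc n) = card (rook_paths_from (Suc h) n)
      + (\<Sum>a=Suc 1..Suc n. card (rook_paths_from (h + a) (Suc n - a)))"
    unfolding up_count_def by (subst sum.atLeast_Suc_atMost) auto
  also have "(\<Sum>a=Suc 1..Suc n. card (rook_paths_from (h + a) (Suc n - a))) = up_count (Suc h) n"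
    unfolding up_count_def by (subst sum.shift_bounds_cl_Suc_ivl) simp
  finally show ?thesis .
qed

text \<open>The factor \<open>fps_X\<close> makes coefficient \<open>n + 1\<close> of
  \<open>U h\<close> depend only on coefficients \<open>n\<close> at height \<open>h + 1\<close>;
  for fixed \<open>n\<close>, the equation for \<open>F\<close> is then solved by induction on
  \<open>h\<close>.\<close>

lemma rook_system_unique:
  fixes F U :: "nat \<Rightarrow> real fps"
  assumes F: "\<And>h. F h = (if h = 0 then 1 else 0) + U h + (\<Sum>i<h. F i)"
    and U: "\<And>h. U h = fps_X * (F (Suc h) + U (Suc h))"
  shows "fps_nth (F h) n = real (card (rook_paths_from h n))"
proof -
  have step: "fps_nth (F h) n = real (card (rook_paths_from h n))"
    if up: "\<And>h. fps_nth (U h) n = real (up_count h n)" for h n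
  proof (induction h rule: less_induct)
    case (less h)
    have "fps_nth (F h) n = (if h = 0 \<and> n = 0 then 1 else 0) + fps_nth (U h) n
        + (\<Sum>i<h. fps_nth (F i) n)"
      by (subst F) (simp add: fps_sum_nth)
    then show ?case
      using less.IH by (subst card_rook_paths_from) (simp add: up)
  qed
  have "fps_nth (U h) n = real (up_count h n)" for h
  proof (induction n arbitrary: h)
    case 0
    show ?case by (subst U) (simp add: up_count_0)
  next
    case (Suc n)
    show ?case
      by (subst U) (simp add: up_count_Suc step Suc.IH)
  qed
  then show ?thesis by (rule step)
qed

lemma P_rook_eq_root:
  assumes root: "4 * fps_X * p ^ 2 + 1 = (1 + 3 * fps_X) * p"
  shows "P_rook = p"
proof -
  define F where "F h = (case h of 0 \<Rightarrow> p | Suc k \<Rightarrow> (2 * p - 1) * p * (2 * p) ^ k)" for h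
  define U where "U h = (p - 1) * (2 * p) ^ h" for h :: nat
  have F_0: "F 0 = p" and F_Suc: "F (Suc k) = (2 * p - 1) * p * (2 * p) ^ k" for k
    by (simp_all add: F_def)
  \<comment> \<open>The factor \<open>2 * p - 1\<close> in \<open>F\<close> makes the partial sums
    geometric.\<close>
  have sum_F: "(\<Sum>i<Suc k. F i) = p * (2 * p) ^ k" for k
    by (induction k) (simp_all add: F_0 F_Suc algebra_simps)
  have F: "F h = (if h = 0 then 1 else 0) + U h + (\<Sum>i<h. F i)" for h
    by (cases h) (simp_all only: F_0 F_Suc sum_F, simp_all add: U_def algebra_simps)
  \<comment> \<open>This is the quadratic rearranged into the equation for \<open>U\<close> at
    height 0; other heights only multiply it by \<open>(2 * p) ^ h\<close>.\<close>
  have key: "p - 1 = fps_X * (p * (2 * p - 1) + (p - 1) * (2 * p))"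
    using root by (simp add: algebra_simps power2_eq_square)
  have U: "U h = fps_X * (F (Suc h) + U (Suc h))" for h
  proof -
    have "U h = fps_X * (p * (2 * p - 1) + (p - 1) * (2 * p)) * (2 * p) ^ h"
      unfolding U_def using key by simp
    then show ?thesis
      by (simp add: U_def F_Suc algebra_simps)
  qed
  have "fps_nth p n = real (p_rook n)" for n
    using rook_system_unique[OF F U, of 0 n] by (simp add: F_0 p_rook_def rook_paths_from_0)
  then show ?thesis
    by (intro fps_ext) (simp add: P_rook_def)
qed

theorem theorem3p1:
  shows "P_rook = (1 + 3 * fps_X - fps_sqrt (1 - 10 * fps_X + 9 * fps_X ^ 2)) / (8 * fps_X)
    \<and> (1 + 3 * fps_X - fps_sqrt (1 - 10 * fps_X + 9 * fps_X ^ 2)) / (8 * fps_X) = rook_beta / 2"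
proof -
  let ?D = "1 - 10 * fps_X + 9 * fps_X ^ 2 :: real fps"
  obtain p where p: "1 + 3 * fps_X - fps_sqrt ?D = 8 * fps_X * p"
    using rook_numerator_dvd[of 8] by (auto simp: numeral_fps_const elim: dvdE)
  have "fps_sqrt ?D ^ 2 = ?D"
    using fps_sqrt_unique[of ?D "fps_sqrt ?D"] by simp
  moreover have "fps_sqrt ?D = 1 + 3 * fps_X - 8 * fps_X * p"
    using p by (simp add: algebra_simps)
  ultimately have "(1 + 3 * fps_X - 8 * fps_X * p) ^ 2 = ?D" by simp
  \<comment> \<open>The factor \<open>16 * fps_X\<close> arises as
    \<open>(1 + 3 * fps_X) ^ 2 - ?D\<close> and cancels in the integral domain of power
    series.\<close>
  then have "(16 * fps_X) * (4 * fps_X * p ^ 2 + 1) = (16 * fps_X) * ((1 + 3 * fps_X) * p)"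
    by (simp add: algebra_simps power2_eq_square)
  then have "4 * fps_X * p ^ 2 + 1 = (1 + 3 * fps_X) * p"
    by simp
  then have "P_rook = p" by (rule P_rook_eq_root)
  moreover have "8 * fps_X * p / (8 * fps_X) = p"
    by (rule nonzero_mult_div_cancel_left) simp
  moreover have "rook_beta / 2 = p"
  proof -
    have "rook_beta = (4 * fps_X) * (2 * p) / (4 * fps_X)"
      unfolding rook_beta_def p by (simp add: mult_ac)
    also have "\<dots> = 2 * p"
      by (rule nonzero_mult_div_cancel_left) simp
    finally have "rook_beta = 2 * p" .
    moreover have "2 * p / 2 = p"
      by (rule nonzero_mult_div_cancel_left) simp
    ultimately show ?thesis by simp
  qed
  ultimately show ?thesis
    unfolding p by simp
qed

end
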